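(* In Model II (described in the context), the exact tail asymptotics in the marginal stationary distribution $\pi_n^{(l)}$ of the low-priority queue is given by $$\pi_n^{(l)}=\frac{\mu_2}{\lambda_2}\,\pi_{2,(0,n+1)}^{(0)} .$$
   Context: Model II is the following preemptive priority queue with $N$-policy vacation, where $N\ge 1$ is an integer. High-priority and low-priority customers arrive according to independent Poisson processes with rates $\lambda_1>0$ and $\lambda_2>0$. Service times are exponential with rates $\mu_1>0$ (high priority) and $\mu_2>0$ (low priority), mutually independent and independent of the arrivals. A single server serves each class in first-come-first-served order, and high-priority customers have preemptive priority over low-priority customers. The server takes a vacation once the system empties, and goes back to work once the number of low-priority customers reaches $N$ or a high-priority customer arrives. Put $\rho_1=\lambda_1/\mu_1$ and $\rho_2=\lambda_2/\mu_2$, and assume $\rho_1+\rho_2<1$. Without loss of generality, time is scaled so that $\lambda_1+\lambda_2+\mu_1+\mu_2=1$. For $i\ge1$, $j\ge0$, $\pi_{1,(i,j)}^{(0)}$ is the stationary probability that the server is serving a high-priority customer with $i$ high-priority and $j$ low-priority customers present. For $j\ge1$, $\pi_{2,(0,j)}^{(0)}$ is the stationary probability that the server is serving a low-priority customer with no high-priority and $j$ low-priority customers present. The marginal stationary distribution of the number of low-priority customers is denoted by $\pi_j^{(l)}$, and for $j>0$ it is written as $\pi_j^{(l)}=\pi_{1,j}^{(l)}+\pi_{2,j}^{(l)}$, where $\pi_{s,j}^{(l)}$ is the marginal distribution of the low-priority customers when the server is at the high-priority queue ($s=1$) or at the low-priority queue ($s=2$); that is, $\pi_{1,j}^{(l)}=\sum_{i\ge1}\pi_{1,(i,j)}^{(0)}$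 and $\pi_{2,j}^{(l)}=\pi_{2,(0,j)}^{(0)}$. The identity is stated as a description of the tail of $\pi_n^{(l)}$ (large $n$), with no explicit range of $n$ specified. *)

theory Defs
  imports "HOL-Probability.Probability"
begin

subsection \<open>Continuous-time Markov chains on a countable state space\<close>

text \<open>
  \<open>P t x\<close> is the law at time \<open>t\<close> of the chain started in \<open>x\<close>: an honest Markov semigroup on \<open>S\<close>
  whose right derivative at time 0 is the generator matrix \<open>Q\<close>. When the diagonal entries of \<open>Q\<close>
  are bounded, as they are below, \<open>Q\<close> determines \<open>P\<close>.
\<close>

definition ctmc :: "'s set \<Rightarrow> ('s \<Rightarrow> 's \<Rightarrow> real) \<Rightarrow> (real \<Rightarrow> 's \<Rightarrow> 's pmf) \<Rightarrow> bool" where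
  "ctmc S Q P \<longleftrightarrow>
     (\<forall>x\<in>S. \<forall>t\<ge>0. set_pmf (P t x) \<subseteq> S) \<and>
     (\<forall>x\<in>S. P 0 x = return_pmf x) \<and>
     (\<forall>x\<in>S. \<forall>s\<ge>0. \<forall>t\<ge>0. P (s + t) x = bind_pmf (P s x) (P t)) \<and>
     (\<forall>x\<in>S. \<forall>y\<in>S. ((\<lambda>t. pmf (P t x) y) has_real_derivative Q x y) (at_right 0))"

definition stationary :: "'s set \<Rightarrow> (real \<Rightarrow> 's \<Rightarrow> 's pmf) \<Rightarrow> 's pmf \<Rightarrow> bool" where
  "stationary S P p \<longleftrightarrow> set_pmf p \<subseteq> S \<and> (\<forall>t\<ge>0. bind_pmf p (P t) = p)"

subsection \<open>The preemptive priority queue with N-policy vacation\<close>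

text \<open>
  \<open>Vacation j\<close>: server on vacation, no high-priority and \<open>j\<close> low-priority customers present.
  \<open>High i j\<close>: serving a high-priority customer, with \<open>i\<close> high-priority and \<open>j\<close> low-priority
  customers present. \<open>Low j\<close>: serving a low-priority customer, with no high-priority and \<open>j\<close>
  low-priority customers present. Customers in service are counted. The values of this type
  outside \<open>state_space N\<close> are meaningless. As service times are exponential, a state needs no
  record of an interrupted service.
\<close>

datatype state = Vacation nat | High nat nat | Low nat

definition state_space :: "nat \<Rightarrow> state set" where
  "state_space N =
     {Vacation j | j. j < N} \<union> {High i j | i j. i \<ge> 1} \<union> {Low j | j. j \<ge> 1}"

fun high_arrival :: "state \<Rightarrow> state" where
  "high_arrival (Vacation j) = High 1 j"
| "high_arrival (High i j) = High (i + 1) j"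
| "high_arrival (Low j) = High 1 j"

fun low_arrival :: "nat \<Rightarrow> state \<Rightarrow> state" where
  "low_arrival N (Vacation j) = (if j + 1 < N then Vacation (j + 1) else Low (j + 1))"
| "low_arrival N (High i j) = High i (j + 1)"
| "low_arrival N (Low j) = Low (j + 1)"

text \<open>The state of a working server that has just completed a service and left \<open>i\<close> high-priority and
  \<open>j\<close> low-priority customers behind. A vacation begins only when the whole system is empty, so the
  server also starts on low-priority customers when there are fewer than \<open>N\<close> of them.\<close>

definition working_state :: "nat \<Rightarrow> nat \<Rightarrow> state" where
  "working_state i j = (if i > 0 then High i j else if j > 0 then Low j else Vacation 0)"

fun service_completion :: "state \<Rightarrow> state" where
  "service_completion (Vacation j) = Vacation j"
| "service_completion (High i j) = working_state (i - 1) j"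
| "service_completion (Low j) = working_state 0 (j - 1)"

fun service_rate :: "real \<Rightarrow> real \<Rightarrow> state \<Rightarrow> real" where
  "service_rate mu1 mu2 (Vacation j) = 0"
| "service_rate mu1 mu2 (High i j) = mu1"
| "service_rate mu1 mu2 (Low j) = mu2"

text \<open>No event with a positive rate leaves a state of \<open>state_space N\<close> unchanged, so the first three
  summands make up the off-diagonal part and the last one is the diagonal.\<close>

definition generator :: "nat \<Rightarrow> real \<Rightarrow> real \<Rightarrow> real \<Rightarrow> real \<Rightarrow> state \<Rightarrow> state \<Rightarrow> real" where
  "generator N lam1 lam2 mu1 mu2 x y =
     lam1 * of_bool (y = high_arrival x) +
     lam2 * of_bool (y = low_arrival N x) +
     service_rate mu1 mu2 x * of_bool (y = service_completion x) -
     (lam1 + lam2 + service_rate mu1 mu2 x) * of_bool (y = x)"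

fun low_count :: "state \<Rightarrow> nat" where
  "low_count (Vacation j) = j"
| "low_count (High i j) = j"
| "low_count (Low j) = j"

text \<open>The marginal distribution of the number of low-priority customers. For \<open>0 < n < N\<close> it also
  contains the mass of \<open>Vacation n\<close>.\<close>

definition low_marginal :: "state pmf \<Rightarrow> nat \<Rightarrow> real" where
  "low_marginal p n = pmf (map_pmf low_count p) n"

definition low_marginal_at_high :: "state pmf \<Rightarrow> nat \<Rightarrow> real" where
  "low_marginal_at_high p n = (\<Sum>\<^sub>\<infinity>i\<in>{1..}. pmf p (High i n))"

definition low_marginal_at_low :: "state pmf \<Rightarrow> nat \<Rightarrow> real" where
  "low_marginal_at_low p n = pmf p (Low n)"

end

theory Submission
  imports Defs
begin

text \<open>
  The identity is a cut equation. Let \<open>A\<close> be the set of states with at most \<open>n\<close> low-priority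
  customers. The number of low-priority customers changes by one at a time, so the chain leaves
  \<open>A\<close> only by a low-priority arrival that finds \<open>n\<close> low-priority customers, and it enters \<open>A\<close>
  only by a low-priority service completion in \<open>Low (n + 1)\<close>. The first happens at rate \<open>lam2\<close>
  whatever the server is doing, the second at rate \<open>mu2\<close> in a single state. In equilibrium the
  probability flows balance: \<open>lam2 * low_marginal p n = mu2 * pmf p (Low (n + 1))\<close>.

  As \<open>A\<close> is infinite and stationarity is a property of the semigroup, balance across the cut has
  to be obtained from the derivatives at time 0 of single transition probabilities. In
  \<open>stationary_flow_balance\<close> the equation
  \<open>(\<Sum>x. p x * (P t x A - indicator A x)) / t = 0\<close> is differentiated under the sum as \<open>t\<close> tends
  to 0. Two facts make this possible. Pointwise, \<open>t \<mapsto> P t x A\<close> has the derivative given by the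
  generator although \<open>A\<close> is infinite: \<open>x\<close> and its finitely many target states carry all the mass
  up to \<open>o(t)\<close>, because the entries of row \<open>x\<close> of the generator at these states sum to zero
  (\<open>ctmc_hitting_difference_quotient\<close>). Uniformly in \<open>x\<close>, the difference quotients are bounded by the
  largest total exit rate (\<open>ctmc_leaving_prob_le\<close>), which is at most \<open>lam1 + lam2 + mu1 + mu2\<close>
  in the queue.
\<close>

section \<open>Flow balance for stationary continuous-time Markov chains\<close>

lemma ctmc_difference_quotient:
  assumes "ctmc S Q P" "x \<in> S" "y \<in> S"
  shows "((\<lambda>t. (pmf (P t x) y - of_bool (x = y)) / t) \<longlongrightarrow> Q x y) (at_right 0)"
proof -
  have "((\<lambda>t. pmf (P t x) y) has_real_derivative Q x y) (at_right 0)" and "P 0 x = return_pmf x"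
    using assms by (auto simp: ctmc_def)
  then show ?thesis
    by (cases "x = y") (auto simp: has_field_derivative_iff pmf_return)
qed

lemma prob_diff_indicator_le:
  fixes D :: "'s pmf"
  shows "\<bar>measure_pmf.prob D A - indicat_real A x\<bar> \<le> 1 - pmf D x"
proof (cases "x \<in> A")
  case True
  then have "measure_pmf.prob D {x} \<le> measure_pmf.prob D A"
    by (intro measure_pmf.finite_measure_mono) auto
  with True show ?thesis by (simp add: measure_pmf_single)
next
  case False
  then have "measure_pmf.prob D A \<le> measure_pmf.prob D (- {x})"
    by (intro measure_pmf.finite_measure_mono) auto
  also have "\<dots> = 1 - pmf D x"
    using measure_pmf.prob_compl[of "{x}" D] by (simp add: measure_pmf_single Compl_eq_Diff_UNIV)
  finally show ?thesis using False by simp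
qed

text \<open>One way to be in \<open>x\<close> at time \<open>s + t\<close> is to be there at time \<open>s\<close> already.\<close>

lemma ctmc_pmf_self_supermult:
  assumes "ctmc S Q P" "x \<in> S" "s \<ge> 0" "t \<ge> 0"
  shows "pmf (P (s + t) x) x \<ge> pmf (P s x) x * pmf (P t x) x"
proof -
  have "pmf (P s x) x * pmf (P t x) x = (\<integral>y. pmf (P t x) x * indicat_real {x} y \<partial>P s x)"
    by (simp add: measure_pmf_single)
  also have "\<dots> \<le> (\<integral>y. pmf (P t y) x \<partial>P s x)"
    by (intro integral_mono measure_pmf.integrable_const_bound[where B = 1])
       (auto simp: pmf_le_1 indicator_def)
  also have "\<dots> = pmf (P (s + t) x) x"
    using assms by (simp add: ctmc_def pmf_bind)
  finally show ?thesis .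
qed

text \<open>
  The probability of having left \<open>x\<close> is subadditive in time: cutting \<open>[0, t]\<close> into \<open>n\<close> equal parts
  bounds it by \<open>n\<close> times its value at \<open>t / n\<close>, which tends to \<open>t\<close> times its derivative at 0.
\<close>

lemma ctmc_leaving_prob_le:
  assumes chain: "ctmc S Q P" and x: "x \<in> S" and t: "t \<ge> 0"
  shows "1 - pmf (P t x) x \<le> - Q x x * t"
proof (cases "t = 0")
  case True
  with chain x show ?thesis by (simp add: ctmc_def)
next
  case False
  with t have t: "t > 0" by simp
  define g where "g s = 1 - pmf (P s x) x" for s
  have subadd: "g (r + s) \<le> g r + g s" if "r \<ge> 0" "s \<ge> 0" for r s
  proof -
    have "(1 - pmf (P r x) x) * (1 - pmf (P s x) x) \<ge> 0"
      by (simp add: pmf_le_1)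
    with ctmc_pmf_self_supermult[OF chain x that] show ?thesis
      by (simp add: g_def algebra_simps)
  qed
  have mult: "g (real n * s) \<le> real n * g s" if "s \<ge> 0" for n s
  proof (induction n)
    case 0
    from chain x show ?case by (simp add: g_def ctmc_def)
  next
    case (Suc n)
    have "g (real (Suc n) * s) \<le> g (real n * s) + g s"
      using subadd[of "real n * s" s] that by (simp add: algebra_simps)
    with Suc show ?case by (simp add: algebra_simps)
  qed
  define h where "h = (\<lambda>n. t * inverse (real (Suc n)))"
  have "filterlim h (at_right 0) sequentially"
    using t LIMSEQ_inverse_real_of_nat[THEN tendsto_mult_right_zero, of t]
    by (intro tendsto_imp_filterlim_at_right) (auto simp: h_def)
  from filterlim_compose[OF ctmc_difference_quotient[OF chain x x] this]
  have "(\<lambda>n. - t * ((pmf (P (h n) x) x - 1) / h n)) \<longlonglongrightarrow> - t * Q x x"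
    by (intro tendsto_mult tendsto_const) simp
  moreover have "g t \<le> - t * ((pmf (P (h n) x) x - 1) / h n)" for n
  proof -
    have "real (Suc n) * h n = t" and "h n > 0"
      using t by (simp_all add: h_def)
    with mult[of "h n" "Suc n"] have "g t \<le> real (Suc n) * g (h n)"
      by simp
    also have "\<dots> = - t * ((pmf (P (h n) x) x - 1) / h n)"
      using t by (simp add: h_def g_def field_simps)
    finally show ?thesis .
  qed
  ultimately have "g t \<le> - t * Q x x"
    by (intro LIMSEQ_le_const) auto
  then show ?thesis by (simp add: g_def mult.commute)
qed

text \<open>
  Restricting \<open>A\<close> to the finite set \<open>F\<close> loses at most the probability of being outside \<open>F\<close>, whose
  derivative at 0 is minus the sum of the generator entries over \<open>F\<close>, that is, zero. So the difference quotients
  for \<open>A\<close> and for \<open>A \<inter> F\<close> have the same limit.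
\<close>

lemma ctmc_hitting_difference_quotient:
  assumes chain: "ctmc S Q P" and x: "x \<in> S"
    and F: "finite F" "F \<subseteq> S" "x \<in> F" "(\<Sum>y\<in>F. Q x y) = 0"
  shows "((\<lambda>t. (measure_pmf.prob (P t x) A - indicat_real A x) / t) \<longlongrightarrow> (\<Sum>y\<in>F \<inter> A. Q x y))
           (at_right 0)"
proof -
  define d where "d B t = (\<Sum>y\<in>B. (pmf (P t x) y - of_bool (x = y)) / t)" for B t
  have lim: "(d B \<longlongrightarrow> (\<Sum>y\<in>B. Q x y)) (at_right 0)" if "B \<subseteq> F" for B
    unfolding d_def using that F(2)
    by (intro tendsto_sum ctmc_difference_quotient[OF chain x]) auto
  have d_eq: "d B t = (measure_pmf.prob (P t x) B - indicat_real B x) / t" if "B \<subseteq> F" for B t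
  proof -
    have "finite B" using that F(1) finite_subset by blast
    then show ?thesis
      by (simp add: d_def measure_measure_pmf_finite sum_divide_distrib[symmetric]
            sum_subtractf indicator_def of_bool_def)
  qed
  have lower: "d (F \<inter> A) t \<le> (measure_pmf.prob (P t x) A - indicat_real A x) / t" if "t > 0" for t
  proof -
    have "measure_pmf.prob (P t x) (F \<inter> A) \<le> measure_pmf.prob (P t x) A"
      by (intro measure_pmf.finite_measure_mono) auto
    with that F(3) show ?thesis
      by (auto simp: d_eq indicator_def intro!: divide_right_mono)
  qed
  have upper: "(measure_pmf.prob (P t x) A - indicat_real A x) / t \<le> d (F \<inter> A) t - d F t"
    if "t > 0" for t
  proof -
    have "measure_pmf.prob (P t x) A \<le> measure_pmf.prob (P t x) ((F \<inter> A) \<union> (- F))"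
      by (intro measure_pmf.finite_measure_mono) auto
    also have "\<dots> \<le> measure_pmf.prob (P t x) (F \<inter> A) + measure_pmf.prob (P t x) (- F)"
      by (intro measure_Un_le) auto
    also have "measure_pmf.prob (P t x) (- F) = 1 - measure_pmf.prob (P t x) F"
      using measure_pmf.prob_compl[of F "P t x"] by (simp add: Compl_eq_Diff_UNIV)
    finally have "measure_pmf.prob (P t x) A
        \<le> measure_pmf.prob (P t x) (F \<inter> A) + (1 - measure_pmf.prob (P t x) F)" .
    with that F(3) show ?thesis
      by (auto simp: d_eq indicator_def diff_divide_distrib[symmetric] intro!: divide_right_mono)
  qed
  show ?thesis
  proof (rule tendsto_sandwich)
    show "(d (F \<inter> A) \<longlongrightarrow> (\<Sum>y\<in>F \<inter> A. Q x y)) (at_right 0)"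
      by (rule lim) auto
    show "((\<lambda>t. d (F \<inter> A) t - d F t) \<longlongrightarrow> (\<Sum>y\<in>F \<inter> A. Q x y)) (at_right 0)"
      using tendsto_diff[OF lim[of "F \<inter> A"] lim[of F]] F(4) by simp
  qed (use lower upper in \<open>auto simp: eventually_at_filter\<close>)
qed

lemma prob_bind_pmf:
  "measure_pmf.prob (bind_pmf p f) A = (\<integral>x. measure_pmf.prob (f x) A \<partial>measure_pmf p)"
  unfolding measure_pmf_bind
  by (rule measure_pmf.measure_bind[where N = "count_space UNIV"]) (simp_all add: measure_pmf_in_subprob_algebra)

text \<open>
  In equilibrium the mean net rate of flow into any set of states vanishes. For a state \<open>x\<close>, \<open>F x\<close>
  consists of \<open>x\<close> and the targets of its transitions.
\<close>

lemma stationary_flow_balance: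
  assumes chain: "ctmc S Q P" and stat: "stationary S P p"
    and F: "\<And>x. x \<in> S \<Longrightarrow> finite (F x)" "\<And>x. x \<in> S \<Longrightarrow> F x \<subseteq> S" "\<And>x. x \<in> S \<Longrightarrow> x \<in> F x"
      "\<And>x. x \<in> S \<Longrightarrow> (\<Sum>y\<in>F x. Q x y) = 0"
    and q: "\<And>x. x \<in> S \<Longrightarrow> - Q x x \<le> q"
  shows "measure_pmf.expectation p (\<lambda>x. \<Sum>y\<in>F x \<inter> A. Q x y) = 0"
proof -
  define h where "h = (\<lambda>n. inverse (real (Suc n)))"
  define u where "u n x = (measure_pmf.prob (P (h n) x) A - indicat_real A x) / h n" for n x
  have h_pos: "h n > 0" for n by (simp add: h_def)
  have h_lim: "filterlim h (at_right 0) sequentially"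
    using LIMSEQ_inverse_real_of_nat
    by (intro tendsto_imp_filterlim_at_right) (auto simp: h_def)
  have p_S: "set_pmf p \<subseteq> S" and p_bind: "bind_pmf p (P (h n)) = p" for n
    using stat h_pos[of n] by (auto simp: stationary_def)
  have "(\<lambda>n. measure_pmf.expectation p (u n))
      \<longlonglongrightarrow> measure_pmf.expectation p (\<lambda>x. \<Sum>y\<in>F x \<inter> A. Q x y)"
  proof (rule integral_dominated_convergence[where w = "\<lambda>_. q"])
    show "AE x in measure_pmf p. (\<lambda>n. u n x) \<longlonglongrightarrow> (\<Sum>y\<in>F x \<inter> A. Q x y)"
    proof (rule AE_pmfI)
      fix x assume "x \<in> set_pmf p"
      with p_S have "x \<in> S" by auto
      from filterlim_compose[OF
          ctmc_hitting_difference_quotient[OF chain this F[OF this]] h_lim]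
      show "(\<lambda>n. u n x) \<longlonglongrightarrow> (\<Sum>y\<in>F x \<inter> A. Q x y)"
        by (simp add: u_def)
    qed
    show "AE x in measure_pmf p. norm (u n x) \<le> q" for n
    proof (rule AE_pmfI)
      fix x assume "x \<in> set_pmf p"
      with p_S have x: "x \<in> S" by auto
      have "\<bar>measure_pmf.prob (P (h n) x) A - indicat_real A x\<bar> \<le> 1 - pmf (P (h n) x) x"
        by (rule prob_diff_indicator_le)
      also have "\<dots> \<le> - Q x x * h n"
        using ctmc_leaving_prob_le[OF chain x, of "h n"] h_pos[of n] by simp
      also have "\<dots> \<le> q * h n"
        using q[OF x] h_pos[of n] by (intro mult_right_mono) auto
      finally show "norm (u n x) \<le> q"
        using h_pos[of n] by (simp add: u_def divide_le_eq)
    qed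
  qed simp_all
  moreover have "measure_pmf.expectation p (u n) = 0" for n
  proof -
    have "measure_pmf.expectation p (u n)
        = ((\<integral>x. measure_pmf.prob (P (h n) x) A \<partial>p) - (\<integral>x. indicat_real A x \<partial>p)) / h n"
      unfolding u_def integral_divide_zero
      by (subst Bochner_Integration.integral_diff)
         (auto intro!: measure_pmf.integrable_const_bound[where B = 1])
    also have "\<dots> = 0"
      by (simp add: prob_bind_pmf[symmetric] p_bind)
    finally show ?thesis .
  qed
  ultimately show ?thesis
    using LIMSEQ_unique[OF tendsto_const] by fastforce
qed

section \<open>The cut between \<open>n\<close> and \<open>n + 1\<close> low-priority customers\<close>

lemma successors_in_state_space:
  assumes "N \<ge> 1" "x \<in> state_space N"
  shows "{x, high_arrival x, low_arrival N x, service_completion x} \<subseteq> state_space N"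
  using assms by (cases x) (auto simp: state_space_def working_state_def)

lemma sum_generator:
  assumes "finite B"
  shows "(\<Sum>y\<in>B. generator N lam1 lam2 mu1 mu2 x y) =
      lam1 * of_bool (high_arrival x \<in> B) + lam2 * of_bool (low_arrival N x \<in> B) +
      service_rate mu1 mu2 x * of_bool (service_completion x \<in> B) -
      (lam1 + lam2 + service_rate mu1 mu2 x) * of_bool (x \<in> B)"
  using assms
  by (simp add: generator_def sum.distrib sum_subtractf sum_distrib_left[symmetric] of_bool_def)

lemma net_flow_below_cut:
  assumes "x \<in> state_space N"
  shows "(\<Sum>y\<in>{x, high_arrival x, low_arrival N x, service_completion x} \<inter> {y. low_count y \<le> n}.
           generator N lam1 lam2 mu1 mu2 x y) =
         mu2 * indicator {Low (n + 1)} x - lam2 * indicator {y. low_count y = n} x"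
  using assms
  by (subst sum_generator)
     (cases x; auto simp: state_space_def working_state_def indicator_def)+

lemma diagonal_generator_le:
  assumes "lam1 > 0" "lam2 > 0" "mu1 > 0" "mu2 > 0"
  shows "- generator N lam1 lam2 mu1 mu2 x x \<le> lam1 + lam2 + mu1 + mu2"
  using assms by (cases x) (auto simp: generator_def of_bool_def)

lemma low_marginal_eq_prob: "low_marginal p n = measure_pmf.prob p {y. low_count y = n}"
  by (simp add: low_marginal_def pmf_map vimage_def)

lemma cut_balance:
  assumes "N \<ge> 1" and pos: "lam1 > 0" "lam2 > 0" "mu1 > 0" "mu2 > 0"
    and chain: "ctmc (state_space N) (generator N lam1 lam2 mu1 mu2) P"
    and stat: "stationary (state_space N) P p"
  shows "lam2 * low_marginal p n = mu2 * pmf p (Low (n + 1))"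
proof -
  define F where "F x = {x, high_arrival x, low_arrival N x, service_completion x}" for x
  have "0 = measure_pmf.expectation p
      (\<lambda>x. \<Sum>y\<in>F x \<inter> {y. low_count y \<le> n}. generator N lam1 lam2 mu1 mu2 x y)"
  proof (rule stationary_flow_balance[OF chain stat, symmetric])
    show "F x \<subseteq> state_space N" if "x \<in> state_space N" for x
      using successors_in_state_space[OF \<open>N \<ge> 1\<close> that] by (simp add: F_def)
    show "(\<Sum>y\<in>F x. generator N lam1 lam2 mu1 mu2 x y) = 0" for x
      by (subst sum_generator) (auto simp: F_def)
  qed (auto simp: F_def intro: diagonal_generator_le[OF pos])
  also have "\<dots> = measure_pmf.expectation p
      (\<lambda>x. mu2 * indicator {Low (n + 1)} x - lam2 * indicator {y. low_count y = n} x)"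
  proof (rule integral_cong_AE)
    show "AE x in measure_pmf p.
        (\<Sum>y\<in>F x \<inter> {y. low_count y \<le> n}. generator N lam1 lam2 mu1 mu2 x y) =
        mu2 * indicator {Low (n + 1)} x - lam2 * indicator {y. low_count y = n} x"
      using stat unfolding F_def stationary_def
      by (intro AE_pmfI net_flow_below_cut) auto
  qed simp_all
  also have "\<dots> = mu2 * pmf p (Low (n + 1)) - lam2 * low_marginal p n"
    by (subst Bochner_Integration.integral_diff)
       (auto simp: measure_pmf_single low_marginal_eq_prob
          intro!: measure_pmf.integrable_const_bound[where B = 1])
  finally show ?thesis by simp
qed

lemma prob_High_eq_low_marginal_at_high:
  "measure_pmf.prob p ((\<lambda>i. High i n) ` {1..}) = low_marginal_at_high p n"
proof -
  have "measure_pmf.prob p ((\<lambda>i. High i n) ` {1..}) = (\<Sum>\<^sub>\<infinity>x\<in>(\<lambda>i. High i n) ` {1..}. pmf p x)"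
    by (simp add: measure_pmf_conv_infsetsum infsetsum_infsum pmf_abs_summable)
  also have "\<dots> = low_marginal_at_high p n"
    unfolding low_marginal_at_high_def by (subst infsum_reindex) (auto simp: inj_on_def o_def)
  finally show ?thesis .
qed

lemma low_marginal_decomposition:
  assumes p_S: "set_pmf p \<subseteq> state_space N" and n: "n \<ge> N"
  shows "low_marginal p n = low_marginal_at_high p n + low_marginal_at_low p n"
proof -
  let ?H = "(\<lambda>i. High i n) ` {1..}"
  \<comment> \<open>\<open>Vacation n\<close> is outside the state space as \<open>n \<ge> N\<close>.\<close>
  have "low_marginal p n = measure_pmf.prob p (?H \<union> {Low n})"
    unfolding low_marginal_eq_prob
  proof (rule measure_pmf.finite_measure_eq_AE)
    show "AE x in measure_pmf p. x \<in> {y. low_count y = n} \<longleftrightarrow> x \<in> ?H \<union> {Low n}"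
      using p_S n by (intro AE_pmfI) (auto simp: state_space_def)
  qed simp_all
  also have "\<dots> = measure_pmf.prob p ?H + measure_pmf.prob p {Low n}"
    by (rule measure_pmf.finite_measure_Union) auto
  finally show ?thesis
    by (simp only: prob_High_eq_low_marginal_at_high low_marginal_at_low_def measure_pmf_single)
qed

theorem theorem5:
  fixes N :: nat and lam1 lam2 mu1 mu2 rho1 rho2 :: real
    and P :: "real \<Rightarrow> state \<Rightarrow> state pmf" and p :: "state pmf"
  assumes "N \<ge> 1"
    and "lam1 > 0" and "lam2 > 0" and "mu1 > 0" and "mu2 > 0"
    and "rho1 = lam1 / mu1" and "rho2 = lam2 / mu2" and "rho1 + rho2 < 1"
    and "lam1 + lam2 + mu1 + mu2 = 1"
    and "ctmc (state_space N) (generator N lam1 lam2 mu1 mu2) P"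
    and "stationary (state_space N) P p"
  shows "(\<forall>n. low_marginal p n = mu2 / lam2 * pmf p (Low (n + 1))) \<and>
         (\<forall>n\<ge>N. low_marginal p n = low_marginal_at_high p n + low_marginal_at_low p n)"
proof (intro conjI allI impI)
  fix n
  show "low_marginal p n = mu2 / lam2 * pmf p (Low (n + 1))"
    using cut_balance[OF assms(1-5,10,11), of n] \<open>lam2 > 0\<close> by (simp add: field_simps)
next
  fix n assume "n \<ge> N"
  with \<open>stationary (state_space N) P p\<close>
  show "low_marginal p n = low_marginal_at_high p n + low_marginal_at_low p n"
    by (intro low_marginal_decomposition) (auto simp: stationary_def)
qed

end
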